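(* The space of invariant spinors on $(S^6=\mathrm G_2/\mathrm{SU}(3),g)$, where $g=B_0|_{\mathfrak m}$, is $$\Sigma_{\mathrm{inv}}=\mathrm{span}_{\mathbb C}\{1,\ y_1\wedge y_2\wedge y_3\},$$ and the spinors $\psi_\pm:=1\pm y_1\wedge y_2\wedge y_3$ are Riemannian Killing spinors: $$\nabla^g_X\psi_\pm=\pm\frac1{2\sqrt3}X\cdot\psi_\pm.$$
   Context: Let $\rho(\epsilon_1),\dots,\rho(\epsilon_7)$ be the following real skew-symmetric $8\times8$ matrices, where $E_{i,j}$ has $-1$ in position $(i,j)$, $+1$ in $(j,i)$ and zeros elsewhere; they satisfy $\rho(\epsilon_i)\rho(\epsilon_j)+\rho(\epsilon_j)\rho(\epsilon_i)=-2\delta_{ij}$: $\rho(\epsilon_1)=E_{1,8}+E_{2,7}-E_{3,6}-E_{4,5}$, $\rho(\epsilon_2)=-E_{1,7}+E_{2,8}+E_{3,5}-E_{4,6}$, $\rho(\epsilon_3)=-E_{1,6}+E_{2,5}-E_{3,8}+E_{4,7}$, $\rho(\epsilon_4)=-E_{1,5}-E_{2,6}-E_{3,7}-E_{4,8}$, $\rho(\epsilon_5)=-E_{1,3}-E_{2,4}+E_{5,7}+E_{6,8}$, $\rho(\epsilon_6)=E_{1,4}-E_{2,3}-E_{5,8}+E_{6,7}$, $\rho(\epsilon_7)=E_{1,2}-E_{3,4}-E_{5,6}+E_{7,8}$. Put $r_{ij}=\rho(\epsilon_i)\rho(\epsilon_j)$, and $B_0(X_1,X_2)=-\mathrm{Re}\,\mathrm{tr}(X_1X_2)$.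 $\mathfrak g_2$ is the Lie algebra of all $\sum_{i<j}\omega_{ij}r_{ij}$ ($\omega_{ij}\in\mathbb R$) with $\omega_{12}+\omega_{34}+\omega_{56}=0$, $-\omega_{13}+\omega_{24}-\omega_{67}=0$, $-\omega_{14}-\omega_{23}-\omega_{57}=0$, $-\omega_{16}-\omega_{25}+\omega_{37}=0$, $\omega_{15}-\omega_{26}-\omega_{47}=0$, $\omega_{17}+\omega_{36}+\omega_{45}=0$, $\omega_{27}+\omega_{35}-\omega_{46}=0$; $\mathfrak h=\mathfrak{su}(3)\subset\mathfrak g_2$ is the subalgebra given by $\omega_{12}+\omega_{34}+\omega_{56}=0$, $\omega_{13}=\omega_{24}$, $\omega_{14}+\omega_{23}=0$, $\omega_{15}=\omega_{26}$, $\omega_{16}+\omega_{25}=0$, $\omega_{35}=\omega_{46}$, $\omega_{36}+\omega_{45}=0$, $\omega_{17}=\dots=\omega_{67}=0$. $\mathfrak m=\mathfrak h^{\perp_{B_0}}\subset\mathfrak g_2$ has $g$-orthonormal basis $e_1=\frac{2r_{17}-r_{36}-r_{45}}{4\sqrt3}$, $e_2=\frac{2r_{27}-r_{35}+r_{46}}{4\sqrt3}$, $e_3=-\frac{r_{13}-r_{24}-2r_{67}}{4\sqrt3}$, $e_4=\frac{r_{14}+r_{23}-2r_{57}}{4\sqrt3}$, $e_5=-\frac{r_{15}-r_{26}+2r_{47}}{4\sqrt3}$, $e_6=\frac{r_{16}+r_{25}+2r_{37}}{4\sqrt3}$. Spin module: $x_j=\frac1{\sqrt2}(e_{2j-1}-ie_{2j})$,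 $y_j=\frac1{\sqrt2}(e_{2j-1}+ie_{2j})$ ($j=1,2,3$), $\Sigma=\Lambda^\bullet\mathrm{span}_{\mathbb C}\{y_1,y_2,y_3\}$, $e_{2j-1}\cdot\eta=i(x_j\lrcorner\eta+y_j\wedge\eta)$, $e_{2j}\cdot\eta=y_j\wedge\eta-x_j\lrcorner\eta$, $x_j\lrcorner$ the antiderivation with $x_j\lrcorner y_k=\delta_{jk}$. The spin lift of $e_i\wedge e_j$ ($e_i\mapsto e_j$, $e_j\mapsto-e_i$) is $\frac12e_i\cdot e_j$. $\Sigma_{\mathrm{inv}}=\{\psi\in\Sigma:\widetilde{\mathrm{ad}(h)|_{\mathfrak m}}\cdot\psi=0\ \forall h\in\mathfrak h\}$ (constant $H$-equivariant maps $G\to\Sigma$). For $\psi\in\Sigma_{\mathrm{inv}}$, at the origin $\nabla^g_X\psi=\widetilde{\Lambda^g(X)}\cdot\psi$ with $\Lambda^g(X)Y=\frac12[X,Y]_{\mathfrak m}+U(X,Y)$, $2g(U(X,Y),Z)=g([Z,X]_{\mathfrak m},Y)+g(X,[Z,Y]_{\mathfrak m})$ (here $U=0$). *)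

theory Defs
  imports "HOL-Analysis.Analysis"
begin

section \<open>The matrices $\rho(\epsilon_i)$ and the Lie algebras\<close>

text \<open>Matrix positions are indexed by the type \<^typ>\<open>8\<close>, whose elements are the numerals
  1, ..., 8 (the numeral 8 being the element 0 of the type).  The indices of
  \<open>rho\<close>, \<open>r\<close>, \<open>\<omega>\<close> and \<open>e\<close> are natural numbers, starting at 1.\<close>

definition E :: "8 \<Rightarrow> 8 \<Rightarrow> real^8^8" where
  "E i j = (\<chi> a b. if a = i \<and> b = j then -1 else if a = j \<and> b = i then 1 else 0)"

definition rho :: "nat \<Rightarrow> real^8^8" where
  "rho i =
    [   E 1 8 + E 2 7 - E 3 6 - E 4 5,
      - E 1 7 + E 2 8 + E 3 5 - E 4 6,
      - E 1 6 + E 2 5 - E 3 8 + E 4 7,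
      - E 1 5 - E 2 6 - E 3 7 - E 4 8,
      - E 1 3 - E 2 4 + E 5 7 + E 6 8,
        E 1 4 - E 2 3 - E 5 8 + E 6 7,
        E 1 2 - E 3 4 - E 5 6 + E 7 8 ] ! (i - 1)"

definition r :: "nat \<Rightarrow> nat \<Rightarrow> real^8^8" where
  "r i j = rho i ** rho j"

text \<open>All matrices here are real, so the real part in the definition of $B_0$ disappears.\<close>

definition B0 :: "real^8^8 \<Rightarrow> real^8^8 \<Rightarrow> real" where
  "B0 X Y = - trace (X ** Y)"

definition commutator :: "real^8^8 \<Rightarrow> real^8^8 \<Rightarrow> real^8^8" where
  "commutator X Y = X ** Y - Y ** X"

definition r_comb :: "(nat \<Rightarrow> nat \<Rightarrow> real) \<Rightarrow> real^8^8" where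
  "r_comb \<omega> = (\<Sum>i\<in>{1..7}. \<Sum>j\<in>{i<..7}. \<omega> i j *\<^sub>R r i j)"

definition g2 :: "(real^8^8) set" where
  "g2 = {r_comb \<omega> | \<omega>.
      \<omega> 1 2 + \<omega> 3 4 + \<omega> 5 6 = 0 \<and>
      - \<omega> 1 3 + \<omega> 2 4 - \<omega> 6 7 = 0 \<and>
      - \<omega> 1 4 - \<omega> 2 3 - \<omega> 5 7 = 0 \<and>
      - \<omega> 1 6 - \<omega> 2 5 + \<omega> 3 7 = 0 \<and>
      \<omega> 1 5 - \<omega> 2 6 - \<omega> 4 7 = 0 \<and>
      \<omega> 1 7 + \<omega> 3 6 + \<omega> 4 5 = 0 \<and>
      \<omega> 2 7 + \<omega> 3 5 - \<omega> 4 6 = 0}"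

definition su3 :: "(real^8^8) set" where
  "su3 = {r_comb \<omega> | \<omega>.
      \<omega> 1 2 + \<omega> 3 4 + \<omega> 5 6 = 0 \<and>
      \<omega> 1 3 = \<omega> 2 4 \<and>
      \<omega> 1 4 + \<omega> 2 3 = 0 \<and>
      \<omega> 1 5 = \<omega> 2 6 \<and>
      \<omega> 1 6 + \<omega> 2 5 = 0 \<and>
      \<omega> 3 5 = \<omega> 4 6 \<and>
      \<omega> 3 6 + \<omega> 4 5 = 0 \<and>
      (\<forall>i\<in>{1..6}. \<omega> i 7 = 0)}"

definition mm :: "(real^8^8) set" where
  "mm = {X \<in> g2. \<forall>Y\<in>su3. B0 X Y = 0}"

definition e :: "nat \<Rightarrow> real^8^8" where
  "e i = (1 / (4 * sqrt 3)) *\<^sub>R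
    ([ 2 *\<^sub>R r 1 7 - r 3 6 - r 4 5,
       2 *\<^sub>R r 2 7 - r 3 5 + r 4 6,
       - (r 1 3 - r 2 4 - 2 *\<^sub>R r 6 7),
       r 1 4 + r 2 3 - 2 *\<^sub>R r 5 7,
       - (r 1 5 - r 2 6 + 2 *\<^sub>R r 4 7),
       r 1 6 + r 2 5 + 2 *\<^sub>R r 3 7 ] ! (i - 1))"

text \<open>The component in \<open>mm\<close> with respect to $\mathfrak g_2 = \mathfrak h \oplus \mathfrak m$;
  only meaningful on elements of \<open>g2\<close>.\<close>

definition m_part :: "real^8^8 \<Rightarrow> real^8^8" where
  "m_part Z = (THE Y. Y \<in> mm \<and> Z - Y \<in> su3)"


section \<open>The Levi-Civita connection\<close>

text \<open>The metric $g$ is the restriction of \<open>B0\<close> to \<open>mm\<close>.\<close>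

definition U :: "real^8^8 \<Rightarrow> real^8^8 \<Rightarrow> real^8^8" where
  "U X Y = (THE W. W \<in> mm \<and>
     (\<forall>Z\<in>mm. 2 * B0 W Z =
        B0 (m_part (commutator Z X)) Y + B0 X (m_part (commutator Z Y))))"

definition Lambda_g :: "real^8^8 \<Rightarrow> real^8^8 \<Rightarrow> real^8^8" where
  "Lambda_g X Y = (1/2) *\<^sub>R m_part (commutator X Y) + U X Y"


section \<open>The spin module\<close>

text \<open>The exterior algebra on three generators $y_1, y_2, y_3$, which stand for the linearly
  independent vectors $y_j = (e_{2j-1} + i e_{2j})/\sqrt 2$ of the complexified \<open>mm\<close>; the
  $x_j = (e_{2j-1} - i e_{2j})/\sqrt 2$ enter only through contraction.  The coefficient at \<open>I\<close> is that
  of the product of the \<open>y i\<close>, \<open>i \<in> I\<close>, taken in increasing order.  In the type \<^typ>\<open>3\<close> the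
  numeral 3 is the element 0, so that the order is 3 < 1 < 2; this only affects the choice of
  monomial basis.\<close>

type_synonym spinor = "complex^(3 set)"

text \<open>The unit of the exterior algebra (\<open>1 :: spinor\<close> would be the vector with all
  coefficients equal to 1).\<close>

definition ext_one :: spinor where
  "ext_one = axis {} 1"

definition y :: "3 \<Rightarrow> spinor" where
  "y j = axis {j} 1"

definition wedge :: "spinor \<Rightarrow> spinor \<Rightarrow> spinor" (infixr \<open>\<and>\<^sub>\<Lambda>\<close> 75) where
  "\<alpha> \<and>\<^sub>\<Lambda> \<beta> = (\<chi> K. \<Sum>I\<in>Pow K.
     (-1) ^ card {(i, j). i \<in> I \<and> j \<in> K - I \<and> j < i} * \<alpha> $ I * \<beta> $ (K - I))"

text \<open>Contraction with $x_j$.  The lemmas below show that it is the antiderivation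
  with $x_j \lrcorner y_k = \delta_{jk}$.\<close>

definition contract :: "3 \<Rightarrow> spinor \<Rightarrow> spinor" where
  "contract j \<eta> = (\<chi> I. if j \<in> I then 0 else (-1) ^ card {i \<in> I. i < j} * \<eta> $ insert j I)"

lemma contract_ext_one: "contract j ext_one = 0"
  by (simp add: contract_def ext_one_def axis_def vec_eq_iff)

lemma contract_y: "contract j (y k) = (if j = k then ext_one else 0)"
  by (auto simp: contract_def ext_one_def y_def axis_def vec_eq_iff)

lemma wedge_ext_one: "ext_one \<and>\<^sub>\<Lambda> \<eta> = \<eta>"
proof -
  have "(ext_one \<and>\<^sub>\<Lambda> \<eta>) $ K = \<eta> $ K" for K
  proof -
    have "(ext_one \<and>\<^sub>\<Lambda> \<eta>) $ K = (\<Sum>I\<in>Pow K. if I = {} then \<eta> $ K else 0)"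
      unfolding wedge_def ext_one_def axis_def
      by (simp only: vec_lambda_beta, intro sum.cong refl) simp
    then show ?thesis by simp
  qed
  then show ?thesis by (simp add: vec_eq_iff)
qed

lemma y_wedge_nth:
  "(y k \<and>\<^sub>\<Lambda> \<eta>) $ K = (if k \<in> K then (-1) ^ card {i \<in> K. i < k} * \<eta> $ (K - {k}) else 0)"
proof -
  have *: "{(i, j). i \<in> {k} \<and> j \<in> K - {k} \<and> j < i} = Pair k ` {i \<in> K. i < k}"
    by auto
  have "(y k \<and>\<^sub>\<Lambda> \<eta>) $ K =
      (\<Sum>I\<in>Pow K. if I = {k} then (-1) ^ card {i \<in> K. i < k} * \<eta> $ (K - {k}) else 0)"
    unfolding wedge_def y_def axis_def
  proof (simp only: vec_lambda_beta, intro sum.cong refl)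
    fix I assume "I \<in> Pow K"
    show "(-1) ^ card {(i, j). i \<in> I \<and> j \<in> K - I \<and> j < i} * (if I = {k} then 1 else 0) *
          \<eta> $ (K - I) = (if I = {k} then (-1) ^ card {i \<in> K. i < k} * \<eta> $ (K - {k}) else 0)"
    proof (cases "I = {k}")
      case True
      have "card (Pair k ` {i \<in> K. i < k}) = card {i \<in> K. i < k}"
        by (intro card_image) (auto simp: inj_on_def)
      with True * show ?thesis by simp
    qed simp
  qed
  then show ?thesis by simp
qed

lemma card_less_insert:
  fixes I :: "3 set"
  assumes "j \<notin> I"
  shows "card {i \<in> insert j I. i < k} = card {i \<in> I. i < k} + (if j < k then 1 else 0)"
proof (cases "j < k")
  case True
  then have "{i \<in> insert j I. i < k} = insert j {i \<in> I. i < k}" by auto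
  with True assms show ?thesis by simp
next
  case False
  then have "{i \<in> insert j I. i < k} = {i \<in> I. i < k}" by auto
  with False show ?thesis by simp
qed

lemma card_less_remove:
  fixes I :: "3 set"
  assumes "k \<in> I"
  shows "card {i \<in> I. i < j} = card {i \<in> I - {k}. i < j} + (if k < j then 1 else 0)"
  using card_less_insert[of k "I - {k}" j] assms by (simp add: insert_absorb)

lemma contract_y_wedge:
  "contract j (y k \<and>\<^sub>\<Lambda> \<eta>) = (if j = k then \<eta> else 0) - y k \<and>\<^sub>\<Lambda> contract j \<eta>"
proof -
  have "contract j (y k \<and>\<^sub>\<Lambda> \<eta>) $ I =
      ((if j = k then \<eta> else 0) - y k \<and>\<^sub>\<Lambda> contract j \<eta>) $ I" for I
  proof (cases "j = k")
    case True
    then show ?thesis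
      using card_less_insert[of k I k] card_less_remove[of k I k]
      by (cases "k \<in> I")
        (simp_all add: contract_def y_wedge_nth insert_absorb mult.assoc[symmetric]
          flip: power_mult_distrib)
  next
    case False
    then have lt: "k < j \<longleftrightarrow> \<not> j < k" by auto
    show ?thesis
    proof (cases "k \<in> I \<and> j \<notin> I")
      case True
      moreover have "insert j I - {k} = insert j (I - {k})" using False by auto
      ultimately show ?thesis
        using False card_less_insert[of j I k] card_less_remove[of k I j]
        by (auto simp: contract_def y_wedge_nth lt split: if_splits)
    next
      case nk: False
      then show ?thesis using False
        by (auto simp: contract_def y_wedge_nth)
    qed
  qed
  then show ?thesis by (simp add: vec_eq_iff)
qed

text \<open>Clifford multiplication by \<open>e (2 * j - 1)\<close> and \<open>e (2 * j)\<close>, \<open>j = 1, 2, 3\<close>, and its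
  linear extension to \<open>mm\<close>.\<close>

definition cliff_e :: "nat \<Rightarrow> spinor \<Rightarrow> spinor" where
  "cliff_e i \<eta> = (let j = of_nat ((i + 1) div 2) in
     if odd i then \<i> *s (contract j \<eta> + y j \<and>\<^sub>\<Lambda> \<eta>) else y j \<and>\<^sub>\<Lambda> \<eta> - contract j \<eta>)"

definition cliff :: "real^8^8 \<Rightarrow> spinor \<Rightarrow> spinor" where
  "cliff X \<eta> = (\<Sum>i\<in>{1..6}. B0 X (e i) *\<^sub>R cliff_e i \<eta>)"

text \<open>A skew-symmetric endomorphism $A$ of $\mathfrak m$ equals
  $\sum_{i<j} g(A e_i, e_j)\, e_i \wedge e_j$, where $e_i \wedge e_j$ maps $e_i$ to $e_j$ and
  $e_j$ to $-e_i$ and has spin lift $\frac12 e_i \cdot e_j$.\<close>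

definition spin_lift :: "(real^8^8 \<Rightarrow> real^8^8) \<Rightarrow> spinor \<Rightarrow> spinor" where
  "spin_lift A \<psi> = (\<Sum>i\<in>{1..6}. \<Sum>j\<in>{i<..6}.
     (B0 (A (e i)) (e j) / 2) *\<^sub>R cliff (e i) (cliff (e j) \<psi>))"

definition Sigma_inv :: "spinor set" where
  "Sigma_inv = {\<psi>. \<forall>h\<in>su3. spin_lift (commutator h) \<psi> = 0}"

text \<open>The covariant derivative at the origin of the invariant spinor field defined by
  an element \<open>\<psi>\<close> of \<open>Sigma_inv\<close>, in the direction \<open>X\<close> of \<open>mm\<close>.\<close>

definition nabla_g :: "real^8^8 \<Rightarrow> spinor \<Rightarrow> spinor" where
  "nabla_g X \<psi> = spin_lift (Lambda_g X) \<psi>"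

definition psi_plus :: spinor where
  "psi_plus = ext_one + y 1 \<and>\<^sub>\<Lambda> y 2 \<and>\<^sub>\<Lambda> y 3"

definition psi_minus :: spinor where
  "psi_minus = ext_one - y 1 \<and>\<^sub>\<Lambda> y 2 \<and>\<^sub>\<Lambda> y 3"

end

theory Submission
  imports Defs
begin

text \<open>
  The idea is to identify everything through Clifford algebra, first that of $\mathbb{R}^7$ acting
  on $\mathbb{R}^8$, then that of $\mathfrak m$ acting on $\Sigma$.

  The products $r_{ij}$, $i < j$, span $\mathfrak{spin}(7)$, are orthogonal for $B_0$ with square
  norm 8, and their brackets follow from the anticommutation of the $\rho(\epsilon_i)$ alone
  (\<open>rho_anticommute\<close>, \<open>commutator_r\<close>, \<open>B0_r\<close>).  The seven equations of $\mathfrak g_2$ say that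
  an element of $\mathfrak{spin}(7)$ annihilates the first basis vector of $\mathbb{R}^8$
  (\<open>g2_iff_annihilates\<close>), which makes it evident that $\mathfrak g_2$ is a subalgebra; and
  $\mathfrak{su}(3)$ is the part of $\mathfrak g_2$ with no component along the $r_{i7}$.  On
  $\mathfrak g_2$ the component along $r_{i7}$ is, up to a factor and a renumbering, the pairing with
  one of the $e_k$, so $\mathfrak{su}(3)$ is the orthogonal complement of the $e_k$ in $\mathfrak g_2$
  (\<open>su3_iff_orthogonal_e\<close>).  Hence the $e_k$ form an orthonormal basis of $\mathfrak m$, the projection
  to $\mathfrak m$ is orthogonal projection, and invariance of $B_0$ gives $U = 0$.  The Levi-Civita
  connection is thus described by the numbers $\frac12 B_0([X, e_i], e_j)$.

  Everything else is contained in the 15 linear forms $Z \mapsto B_0([Z, e_i], e_j)$, $i < j$, on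
  $\mathfrak g_2$ (\<open>B0_commutator_e_e\<close>).

  For $Z \in \mathfrak{su}(3)$ they show that $\mathfrak{su}(3)$ acts on $\mathfrak m = \mathbb{C}^3$ by
  complex linear maps of trace zero (\<open>isotropy_su3\<close>).  This is the standard representation, so that $\Sigma = \Lambda^\bullet \mathbb{C}^3$ is the sum
  of $\Lambda^0$ and $\Lambda^3$, which are trivial, and $\Lambda^1$ and $\Lambda^2$, on which no vector
  is fixed.  For the last point a single generic element of the maximal torus suffices: it acts
  diagonally on the monomials, and only $1$ and $y_1 \wedge y_2 \wedge y_3$ have weight zero
  (\<open>weight_of_invariant_spinor\<close>).

  For $Z \in \mathfrak m$ they are the contractions $Z \lrcorner T$ of the 3-form
  $T = \frac{1}{\sqrt 3} \mathrm{Im}\,(dz_1 \wedge dz_2 \wedge dz_3)$, $z_j = e_{2j-1} + i e_{2j}$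
  (\<open>B0_commutator_mm_e_e\<close>), whence $\nabla^g_X \psi = \frac14 (X \lrcorner T) \cdot \psi$.  Clifford
  multiplication by $T$ is $\mathfrak{su}(3)$-equivariant and changes the parity of the degree.  So it
  is zero on $\Lambda^1$ and $\Lambda^2$, which are not equivalent, and exchanges $\Lambda^0$ and
  $\Lambda^3$; on $\psi_\pm$ it has the eigenvalues $\mp \frac{4}{\sqrt 3}$.  As $X \cdot \psi_\pm$ lies in
  $\Lambda^1 \oplus \Lambda^2$, the identity $X \cdot T + T \cdot X = - 2 X \lrcorner T$ yields
  $(X \lrcorner T) \cdot \psi_\pm = \pm \frac{2}{\sqrt 3} X \cdot \psi_\pm$, the Killing equation.  The
  formal proof checks this last step on the eight coordinates of a spinor
  (\<open>nabla_one_plus_volume\<close>).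
\<close>

text \<open>The number 1 serves as an index of \<open>rho\<close>, \<open>r\<close> and \<open>e\<close>; rewritten to \<open>Suc 0\<close> it would no longer
  match the tables below.\<close>

declare One_nat_def [simp del]

section \<open>The Clifford relations\<close>

lemma UNIV_8: "(UNIV :: 8 set) = {1, 2, 3, 4, 5, 6, 7, 8}"
  by (rule card_subset_eq[symmetric]) simp_all

lemma forall_8: "(\<forall>a::8. P a) \<longleftrightarrow> P 1 \<and> P 2 \<and> P 3 \<and> P 4 \<and> P 5 \<and> P 6 \<and> P 7 \<and> P 8"
proof -
  have "(\<forall>a::8. P a) \<longleftrightarrow> (\<forall>a\<in>UNIV. P a)"
    by simp
  then show ?thesis
    unfolding UNIV_8 by simp
qed

lemma E_mult_vec:
  assumes "i \<noteq> j"
  shows "(E i j *v v) $ a = (if a = i then - v $ j else if a = j then v $ i else 0)"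
proof -
  have "(E i j *v v) $ a =
      (\<Sum>b\<in>UNIV. (if b = j then (if a = i then - v $ j else 0) else 0)
                  + (if b = i then (if a = j then v $ i else 0) else 0))"
    unfolding matrix_vector_mult_def E_def using assms
    by (simp only: vec_lambda_beta, intro sum.cong refl) auto
  also have "\<dots> = (if a = i then - v $ j else 0) + (if a = j then v $ i else 0)"
    by (simp add: sum.distrib)
  finally show ?thesis
    using assms by simp
qed

lemma Ball_1_7: "(\<forall>i\<in>{1..7::nat}. P i) \<longleftrightarrow> P 1 \<and> P 2 \<and> P 3 \<and> P 4 \<and> P 5 \<and> P 6 \<and> P 7"
proof -
  have "{1..7::nat} = {1,2,3,4,5,6,7}" by auto
  then show ?thesis by simp
qed

lemma Ball_1_6: "(\<forall>i\<in>{1..6::nat}. P i) \<longleftrightarrow> P 1 \<and> P 2 \<and> P 3 \<and> P 4 \<and> P 5 \<and> P 6"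
proof -
  have "{1..6::nat} = {1,2,3,4,5,6}" by auto
  then show ?thesis by simp
qed

lemma matrix_vector_neg: "(- A) *v v = - (A *v v)" for A :: "real^'n^'m"
  by (simp add: vec_eq_iff matrix_vector_mult_def sum_negf)

text \<open>Each \<open>rho i\<close> is a signed permutation matrix, so a product of two of them is best evaluated by
  letting them act one after the other on the coordinates of a vector.\<close>

lemma rho_mult_vec:
  "(rho 1 *v v) $ 1 = - v $ 8" "(rho 1 *v v) $ 2 = - v $ 7"
  "(rho 1 *v v) $ 3 = v $ 6" "(rho 1 *v v) $ 4 = v $ 5"
  "(rho 1 *v v) $ 5 = - v $ 4" "(rho 1 *v v) $ 6 = - v $ 3"
  "(rho 1 *v v) $ 7 = v $ 2" "(rho 1 *v v) $ 8 = v $ 1"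
  "(rho 2 *v v) $ 1 = v $ 7" "(rho 2 *v v) $ 2 = - v $ 8"
  "(rho 2 *v v) $ 3 = - v $ 5" "(rho 2 *v v) $ 4 = v $ 6"
  "(rho 2 *v v) $ 5 = v $ 3" "(rho 2 *v v) $ 6 = - v $ 4"
  "(rho 2 *v v) $ 7 = - v $ 1" "(rho 2 *v v) $ 8 = v $ 2"
  "(rho 3 *v v) $ 1 = v $ 6" "(rho 3 *v v) $ 2 = - v $ 5"
  "(rho 3 *v v) $ 3 = v $ 8" "(rho 3 *v v) $ 4 = - v $ 7"
  "(rho 3 *v v) $ 5 = v $ 2" "(rho 3 *v v) $ 6 = - v $ 1"
  "(rho 3 *v v) $ 7 = v $ 4" "(rho 3 *v v) $ 8 = - v $ 3"
  "(rho 4 *v v) $ 1 = v $ 5" "(rho 4 *v v) $ 2 = v $ 6"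
  "(rho 4 *v v) $ 3 = v $ 7" "(rho 4 *v v) $ 4 = v $ 8"
  "(rho 4 *v v) $ 5 = - v $ 1" "(rho 4 *v v) $ 6 = - v $ 2"
  "(rho 4 *v v) $ 7 = - v $ 3" "(rho 4 *v v) $ 8 = - v $ 4"
  "(rho 5 *v v) $ 1 = v $ 3" "(rho 5 *v v) $ 2 = v $ 4"
  "(rho 5 *v v) $ 3 = - v $ 1" "(rho 5 *v v) $ 4 = - v $ 2"
  "(rho 5 *v v) $ 5 = - v $ 7" "(rho 5 *v v) $ 6 = - v $ 8"
  "(rho 5 *v v) $ 7 = v $ 5" "(rho 5 *v v) $ 8 = v $ 6"
  "(rho 6 *v v) $ 1 = - v $ 4" "(rho 6 *v v) $ 2 = v $ 3"
  "(rho 6 *v v) $ 3 = - v $ 2" "(rho 6 *v v) $ 4 = v $ 1"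
  "(rho 6 *v v) $ 5 = v $ 8" "(rho 6 *v v) $ 6 = - v $ 7"
  "(rho 6 *v v) $ 7 = v $ 6" "(rho 6 *v v) $ 8 = - v $ 5"
  "(rho 7 *v v) $ 1 = - v $ 2" "(rho 7 *v v) $ 2 = v $ 1"
  "(rho 7 *v v) $ 3 = v $ 4" "(rho 7 *v v) $ 4 = - v $ 3"
  "(rho 7 *v v) $ 5 = v $ 6" "(rho 7 *v v) $ 6 = - v $ 5"
  "(rho 7 *v v) $ 7 = - v $ 8" "(rho 7 *v v) $ 8 = v $ 7"
  by (simp_all add: rho_def matrix_vector_mult_add_rdistrib matrix_vector_mult_diff_rdistrib
      matrix_vector_neg E_mult_vec)

lemma rho_anticommute:
  assumes "i \<in> {1..7}" and "j \<in> {1..7}"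
  shows "rho i ** rho j + rho j ** rho i = (if i = j then -2 else 0) *\<^sub>R mat 1"
proof -
  have "\<forall>i\<in>{1..7}. \<forall>j\<in>{1..7}. \<forall>v.
      rho i *v (rho j *v v) + rho j *v (rho i *v v) = (if i = j then -2 else 0) *\<^sub>R v"
    unfolding Ball_1_7 vec_eq_iff forall_8
    by (simp add: rho_mult_vec)
  then show ?thesis
    using assms
    by (simp add: matrix_eq matrix_vector_mult_add_rdistrib scaleR_matrix_vector_assoc[symmetric]
        flip: matrix_vector_mul_assoc)
qed

section \<open>Brackets and traces of products of two generators\<close>

lemma matrix_add_rdistrib: "(A + B) ** C = A ** C + B ** C" for A B :: "'a::semiring_1^'m^'n"
  by (vector matrix_matrix_mult_def sum.distrib[symmetric] field_simps)

interpretation matmul: bounded_bilinear "(**) :: real^8^8 \<Rightarrow> real^8^8 \<Rightarrow> real^8^8"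
  unfolding bilinear_conv_bounded_bilinear[symmetric] bilinear_def
  by (auto intro!: linearI simp: matrix_add_ldistrib matrix_add_rdistrib matrix_scalar_ac
      scalar_matrix_assoc)

interpretation commutator: bounded_bilinear commutator
  unfolding bilinear_conv_bounded_bilinear[symmetric] bilinear_def commutator_def
  by (auto intro!: linearI simp: matmul.add_left matmul.add_right matmul.scaleR_left
      matmul.scaleR_right scaleR_diff_right)

interpretation B0: bounded_bilinear B0
  unfolding bilinear_conv_bounded_bilinear[symmetric] bilinear_def B0_def
  by (auto intro!: linearI simp: matmul.add_left matmul.add_right matmul.scaleR_left
      matmul.scaleR_right trace_def sum.distrib sum_distrib_left)

lemma B0_commute: "B0 X Y = B0 Y X"
  unfolding B0_def by (subst trace_mul_sym) (rule refl)

text \<open>The invariance of the form, which is the cyclicity of the trace.  It moves the bracket in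
  $B_0([Z, e_i], e_j)$ away from the variable argument \<open>Z\<close>.\<close>

lemma B0_commutator: "B0 (commutator X Y) Z = B0 X (commutator Y Z)"
proof -
  have "trace (Y ** X ** Z) = trace (X ** (Z ** Y))"
    using trace_mul_sym[of Y "X ** Z"] by (simp add: matrix_mul_assoc)
  then show ?thesis
    unfolding B0_def commutator_def
    by (simp add: matmul.diff_left matmul.diff_right trace_sub matrix_mul_assoc)
qed

lemma commutator_swap: "commutator Y X = - commutator X Y"
  by (simp add: commutator_def)

lemma rho_swap:
  assumes "i \<in> {1..7}" and "j \<in> {1..7}"
  shows "rho i ** rho j = (if i = j then -2 else 0) *\<^sub>R mat 1 - rho j ** rho i"
  using rho_anticommute[OF assms] by (simp add: eq_diff_eq)

lemma r_same: "i \<in> {1..7} \<Longrightarrow> r i i = - mat 1"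
proof -
  assume "i \<in> {1..7}"
  then have "2 *\<^sub>R r i i = 2 *\<^sub>R (- mat 1)"
    using rho_anticommute[of i i] by (simp add: r_def scaleR_2)
  then show ?thesis
    by (simp only: scaleR_cancel_left) simp
qed

text \<open>Moving \<open>rho k\<close> to the left past the two factors of \<open>r i j\<close> gives two signs, which cancel; the
  correction terms show that the bracket with \<open>r i j\<close> is a multiple of an infinitesimal rotation on the
  span of the generators.\<close>

lemma r_rho:
  assumes "i \<in> {1..7}" and "j \<in> {1..7}" and "k \<in> {1..7}"
  shows "r i j ** rho k = rho k ** r i j + (if i = k then 2 else 0) *\<^sub>R rho j
    - (if j = k then 2 else 0) *\<^sub>R rho i"
proof -
  have "r i j ** rho k = rho i ** (rho j ** rho k)"
    by (simp add: r_def matrix_mul_assoc)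
  also have "\<dots> = - (if j = k then 2 else 0) *\<^sub>R rho i - (rho i ** rho k) ** rho j"
    by (subst rho_swap[of j k]) (use assms in \<open>auto simp: matmul.diff_right matmul.minus_right
        matmul.scaleR_right matrix_mul_assoc\<close>)
  also have "(rho i ** rho k) ** rho j = - (if i = k then 2 else 0) *\<^sub>R rho j - rho k ** r i j"
    by (subst rho_swap[of i k]) (use assms in \<open>auto simp: matmul.diff_left matmul.minus_left
        matmul.scaleR_left matrix_mul_assoc r_def\<close>)
  finally show ?thesis
    by simp
qed

text \<open>Bracketing with \<open>r i j\<close> is a derivation, so \<open>r_rho\<close> applied to the two factors of \<open>r k l\<close> gives the
  bracket.\<close>

lemma commutator_r:
  assumes "i \<in> {1..7}" and "j \<in> {1..7}" and "k \<in> {1..7}" and "l \<in> {1..7}"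
  shows "commutator (r i j) (r k l) =
      (if i = k then 2 else 0) *\<^sub>R r j l - (if j = k then 2 else 0) *\<^sub>R r i l
    + (if i = l then 2 else 0) *\<^sub>R r k j - (if j = l then 2 else 0) *\<^sub>R r k i"
proof -
  have "r i j ** r k l = (r i j ** rho k) ** rho l"
    by (simp add: r_def matrix_mul_assoc)
  also have "\<dots> = rho k ** (r i j ** rho l)
      + (if i = k then 2 else 0) *\<^sub>R r j l - (if j = k then 2 else 0) *\<^sub>R r i l"
    by (subst r_rho) (use assms in \<open>auto simp: matmul.add_left matmul.diff_left
        matmul.scaleR_left matrix_mul_assoc r_def\<close>)
  also have "rho k ** (r i j ** rho l) = r k l ** r i j
      + (if i = l then 2 else 0) *\<^sub>R r k j - (if j = l then 2 else 0) *\<^sub>R r k i"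
    by (subst r_rho) (use assms in \<open>auto simp: matmul.add_right matmul.diff_right
        matmul.scaleR_right matrix_mul_assoc r_def\<close>)
  finally show ?thesis
    by (simp add: commutator_def)
qed

lemma r_swap:
  assumes "i \<in> {1..7}" and "j \<in> {1..7}" and "i \<noteq> j"
  shows "r j i = - r i j"
  using rho_swap[OF assms(2,1)] assms(3) by (simp add: r_def)

lemma B0_mat_1_r:
  assumes "i \<in> {1..7}" and "j \<in> {1..7}"
  shows "B0 (mat 1) (r i j) = (if i = j then 8 else 0)"
proof (cases "i = j")
  case True
  then show ?thesis using assms
    by (simp add: r_same B0.minus_right) (simp add: B0_def trace_I)
next
  case False
  have "B0 (mat 1) (r i j) = B0 (mat 1) (r j i)"
    unfolding B0_def r_def using trace_mul_sym[of "rho i" "rho j"] by simp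
  then show ?thesis using False r_swap[OF assms False]
    by (simp add: B0.minus_right)
qed

text \<open>Move \<open>rho k\<close> once around the trace.  As \<open>rho k\<close> and \<open>rho l\<close> anticommute, the trace comes back with the
  opposite sign, so that twice the trace is the sum of the correction terms of \<open>r_rho\<close>.\<close>

lemma B0_r:
  assumes "i \<in> {1..7}" and "j \<in> {1..7}" and "k \<in> {1..7}" and "l \<in> {1..7}"
    and "i \<noteq> j" and "k \<noteq> l"
  shows "B0 (r i j) (r k l) = (if i = k \<and> j = l then 8 else 0) - (if i = l \<and> j = k then 8 else 0)"
proof -
  have "2 * B0 (r i j) (r k l) = B0 (mat 1) (r i j ** rho k ** rho l) - B0 (mat 1) (r i j ** r l k)"
    using assms r_swap[of k l]
    by (simp add: B0_def r_def matrix_mul_assoc[symmetric] matmul.minus_right B0.minus_right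
        trace_def sum_negf)
  also have "B0 (mat 1) (r i j ** r l k) = B0 (mat 1) (rho k ** r i j ** rho l)"
    using trace_mul_sym[of "r i j ** rho l" "rho k"]
    by (simp add: B0_def r_def matrix_mul_assoc)
  also have "r i j ** rho k ** rho l = rho k ** r i j ** rho l
      + (if i = k then 2 else 0) *\<^sub>R r j l - (if j = k then 2 else 0) *\<^sub>R r i l"
    unfolding r_rho[OF assms(1-3)]
    by (simp add: matmul.add_left matmul.diff_left matmul.scaleR_left r_def)
  finally show ?thesis
    using assms by (auto simp: B0.add_right B0.diff_right B0.scaleR_right B0_mat_1_r)
qed

section \<open>The Lie algebra spanned by the products of two generators\<close>

lemma r_comb_add: "r_comb \<omega> + r_comb \<omega>' = r_comb (\<lambda>i j. \<omega> i j + \<omega>' i j)"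
  by (simp add: r_comb_def sum.distrib scaleR_add_left)

lemma r_comb_scale: "c *\<^sub>R r_comb \<omega> = r_comb (\<lambda>i j. c * \<omega> i j)"
  by (simp add: r_comb_def scaleR_sum_right)

lemma subspace_range_r_comb: "subspace (range r_comb)"
  by (auto intro!: subspaceI simp: r_comb_add r_comb_scale image_iff)
    (metis (no_types) r_comb_scale scaleR_zero_left)

lemma r_in_range_r_comb:
  assumes "i \<in> {1..7}" and "j \<in> {1..7}" and "i \<noteq> j"
  shows "r i j \<in> range r_comb"
proof -
  have less: "r i j \<in> range r_comb" if "i \<in> {1..7}" "j \<in> {1..7}" "i < j" for i j
  proof -
    have "r_comb (\<lambda>a b. if b = j then if a = i then 1 else 0 else 0)
        = (\<Sum>a\<in>{1..7}. \<Sum>b\<in>{a<..7}. if b = j then if a = i then r i j else 0 else 0)"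
      unfolding r_comb_def by (intro sum.cong refl) auto
    also have "\<dots> = (\<Sum>a\<in>{1..7}. if a = i then r i j else 0)"
      by (intro sum.cong refl) (use that in auto)
    also have "\<dots> = r i j"
      using that by simp
    finally show ?thesis
      by (metis rangeI)
  qed
  show ?thesis
  proof (cases "i < j")
    case False
    then have "- r j i \<in> range r_comb"
      using assms less[of j i] subspace_neg[OF subspace_range_r_comb] by simp
    then show ?thesis
      using assms r_swap[of j i] by simp
  qed (use assms less in simp)
qed

lemma commutator_r_comb_closed:
  assumes "X \<in> range r_comb" and "Y \<in> range r_comb"
  shows "commutator X Y \<in> range r_comb"
proof -
  note S = subspace_range_r_comb
  have *: "commutator (r i j) (r k l) \<in> range r_comb"
    if "i \<in> {1..7}" "j \<in> {1..7}" "k \<in> {1..7}" "l \<in> {1..7}" "i < j" "k < l" for i j k l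
    using that r_in_range_r_comb[of j l] r_in_range_r_comb[of i l]
      r_in_range_r_comb[of k j] r_in_range_r_comb[of k i]
    by (auto simp: commutator_r r_same
        intro!: subspace_add[OF S] subspace_diff[OF S] subspace_neg[OF S]
          subspace_scale[OF S] subspace_0[OF S])
  from assms obtain \<omega> \<omega>' where XY: "X = r_comb \<omega>" "Y = r_comb \<omega>'"
    by blast
  have "commutator X Y = (\<Sum>k\<in>{1..7}. \<Sum>l\<in>{k<..7}. \<omega>' k l *\<^sub>R
      (\<Sum>i\<in>{1..7}. \<Sum>j\<in>{i<..7}. \<omega> i j *\<^sub>R commutator (r i j) (r k l)))"
    unfolding XY r_comb_def
    by (simp only: commutator.sum_left commutator.sum_right commutator.scaleR_left
        commutator.scaleR_right)
  then show ?thesis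
    by (auto intro!: subspace_sum[OF S] subspace_scale[OF S] *)
qed

text \<open>The form reads off the coefficients of an element, so that computations below can be phrased in terms
  of the numbers \<open>B0 Z (r i j)\<close> and make no reference to a choice of coefficients.\<close>

lemma B0_r_comb_r:
  assumes "k \<in> {1..7}" and "l \<in> {1..7}" and "k < l"
  shows "B0 (r_comb \<omega>) (r k l) = 8 * \<omega> k l"
proof -
  have "B0 (r_comb \<omega>) (r k l) = (\<Sum>i\<in>{1..7}. \<Sum>j\<in>{i<..7}. \<omega> i j * B0 (r i j) (r k l))"
    by (simp add: r_comb_def B0.sum_left B0.scaleR_left)
  also have "\<dots> = (\<Sum>i\<in>{1..7}. \<Sum>j\<in>{i<..7}. if j = l then if i = k then 8 * \<omega> k l else 0 else 0)"
    by (intro sum.cong refl) (use assms in \<open>auto simp: B0_r\<close>)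
  also have "\<dots> = (\<Sum>i\<in>{1..7}. if i = k then 8 * \<omega> k l else 0)"
    by (intro sum.cong refl) (use assms in auto)
  also have "\<dots> = 8 * \<omega> k l"
    using assms by simp
  finally show ?thesis .
qed

lemma B0_definite_on_r_comb:
  assumes "X \<in> range r_comb" and "B0 X X = 0"
  shows "X = 0"
proof -
  from assms(1) obtain \<omega> where X: "X = r_comb \<omega>"
    by blast
  have "B0 X X = (\<Sum>i\<in>{1..7}. \<Sum>j\<in>{i<..7}. \<omega> i j * B0 X (r i j))"
    by (subst (2) X) (simp add: r_comb_def[of \<omega>] B0.sum_right B0.scaleR_right)
  also have "\<dots> = (\<Sum>i\<in>{1..7}. \<Sum>j\<in>{i<..7}. 8 * (\<omega> i j)\<^sup>2)"
    by (intro sum.cong refl) (simp add: X B0_r_comb_r power2_eq_square)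
  finally have "\<forall>i\<in>{1..7}. \<forall>j\<in>{i<..7}. \<omega> i j = 0"
    using assms(2) by (simp add: sum_nonneg sum_nonneg_eq_0_iff)
  then show ?thesis
    by (simp add: X r_comb_def)
qed

section \<open>The subalgebras $\mathfrak g_2$ and $\mathfrak{su}(3)$\<close>

interpretation matrix_vector_mult: bounded_bilinear "(*v) :: real^8^8 \<Rightarrow> real^8 \<Rightarrow> real^8"
  unfolding bilinear_conv_bounded_bilinear[symmetric] bilinear_def
  by (auto intro!: linearI simp: matrix_vector_mult_add_rdistrib matrix_vector_right_distrib
      matrix_vector_mult_scaleR scaleR_matrix_vector_assoc)

lemma sum_pairs_7:
  fixes f :: "nat \<Rightarrow> nat \<Rightarrow> 'a::comm_monoid_add"
  shows "(\<Sum>i\<in>{1..7}. \<Sum>j\<in>{i<..7}. f i j) =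
    f 1 2 + f 1 3 + f 1 4 + f 1 5 + f 1 6 + f 1 7 + f 2 3 + f 2 4 + f 2 5 + f 2 6 + f 2 7 +
    f 3 4 + f 3 5 + f 3 6 + f 3 7 + f 4 5 + f 4 6 + f 4 7 + f 5 6 + f 5 7 + f 6 7"
proof -
  have I: "{1..7::nat} = {1,2,3,4,5,6,7}" "{1<..7::nat} = {2,3,4,5,6,7}" "{2<..7::nat} = {3,4,5,6,7}"
    "{3<..7::nat} = {4,5,6,7}" "{4<..7::nat} = {5,6,7}" "{5<..7::nat} = {6,7}" "{6<..7::nat} = {7}"
    by auto
  show ?thesis
    unfolding I(1) by (simp add: I(2-) add.assoc)
qed

text \<open>The vector \<open>axis 1 1\<close> is the spinor in $\mathbb{R}^8$ whose stabiliser is $\mathfrak g_2$.  Every \<open>r i j\<close>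
  maps it to a basis vector up to sign, and the three \<open>r i j\<close> with the same image contribute to the same
  equation; the component along the vector itself vanishes identically.\<close>

lemma r_comb_annihilates_axis:
  "r_comb \<omega> *v axis 1 1 = 0 \<longleftrightarrow>
      \<omega> 1 2 + \<omega> 3 4 + \<omega> 5 6 = 0 \<and>
      - \<omega> 1 3 + \<omega> 2 4 - \<omega> 6 7 = 0 \<and>
      - \<omega> 1 4 - \<omega> 2 3 - \<omega> 5 7 = 0 \<and>
      - \<omega> 1 6 - \<omega> 2 5 + \<omega> 3 7 = 0 \<and>
      \<omega> 1 5 - \<omega> 2 6 - \<omega> 4 7 = 0 \<and>
      \<omega> 1 7 + \<omega> 3 6 + \<omega> 4 5 = 0 \<and>
      \<omega> 2 7 + \<omega> 3 5 - \<omega> 4 6 = 0"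
proof -
  have s: "rho 1 *v axis 1 1 = axis 8 1" "rho 2 *v axis 1 1 = - axis 7 1"
    "rho 3 *v axis 1 1 = - axis 6 1" "rho 4 *v axis 1 1 = - axis 5 1"
    "rho 5 *v axis 1 1 = - axis 3 1" "rho 6 *v axis 1 1 = axis 4 1"
    "rho 7 *v axis 1 1 = axis 2 1"
    by (simp_all add: vec_eq_iff forall_8 rho_mult_vec axis_def)
  have ax: "axis k (1::real) $ a = (if a = k then 1 else 0)" for k a :: 8
    by (simp add: axis_def)
  have comp: "(r_comb \<omega> *v axis 1 1) $ a =
      (\<Sum>i\<in>{1..7}. \<Sum>j\<in>{i<..7}. \<omega> i j * (rho i *v (rho j *v axis 1 1)) $ a)" for a
    unfolding r_comb_def r_def
    by (simp add: matrix_vector_mult.sum_left matrix_vector_mult.scaleR_left matrix_vector_mul_assoc)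
  show ?thesis
    unfolding vec_eq_iff forall_8 comp sum_pairs_7 s
    by (auto simp: rho_mult_vec ax)
qed

lemma g2_iff_annihilates: "Z \<in> g2 \<longleftrightarrow> Z \<in> range r_comb \<and> Z *v axis 1 1 = 0"
  by (auto simp: g2_def r_comb_annihilates_axis)

lemma subspace_g2: "subspace g2"
  using subspace_range_r_comb
  by (auto simp: subspace_def g2_iff_annihilates matrix_vector_mult.add_left
      matrix_vector_mult.scaleR_left matrix_vector_mult.zero_left)

lemma commutator_g2: "X \<in> g2 \<Longrightarrow> Y \<in> g2 \<Longrightarrow> commutator X Y \<in> g2"
  unfolding g2_iff_annihilates
  by (simp add: commutator_r_comb_closed)
    (simp add: commutator_def matrix_vector_mult.diff_left matrix_vector_mult.zero_right
      flip: matrix_vector_mul_assoc)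

text \<open>$\mathfrak{su}(3)$ is the stabiliser of the spinor in $\mathfrak{spin}(6)$: if all $\omega_{i7}$ vanish,
  the seven equations of $\mathfrak g_2$ become those of $\mathfrak{su}(3)$.\<close>

lemma su3_iff_g2_spin6: "Z \<in> su3 \<longleftrightarrow> Z \<in> g2 \<and> (\<forall>i\<in>{1..6}. B0 Z (r i 7) = 0)"
proof -
  have "B0 (r_comb \<omega>) (r i 7) = 0 \<longleftrightarrow> \<omega> i 7 = 0" if "i \<in> {1..6}" for \<omega> i
    using that by (simp add: B0_r_comb_r)
  then have "(\<forall>i\<in>{1..6}. B0 (r_comb \<omega>) (r i 7) = 0) \<longleftrightarrow> (\<forall>i\<in>{1..6}. \<omega> i 7 = 0)" for \<omega>
    by blast
  then have "Z \<in> g2 \<and> (\<forall>i\<in>{1..6}. B0 Z (r i 7) = 0) \<longleftrightarrow> (\<exists>\<omega>. Z = r_comb \<omega> \<and>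
      r_comb \<omega> *v axis 1 1 = 0 \<and> (\<forall>i\<in>{1..6}. \<omega> i 7 = 0))"
    by (auto simp: g2_iff_annihilates)
  also have "\<dots> \<longleftrightarrow> Z \<in> su3"
    unfolding su3_def mem_Collect_eq r_comb_annihilates_axis Ball_1_6
    by (intro iff_exI) auto
  finally show ?thesis by blast
qed

lemma sqrt_3_scale: "1 / (4 * sqrt 3) = sqrt 3 / 12"
  by (simp add: field_simps)

text \<open>With $\frac{1}{4 \sqrt 3}$ written as $\frac{\sqrt 3}{12}$, the square root only ever occurs in numerators.\<close>

lemma e_eqs:
  "e 1 = (sqrt 3 / 12) *\<^sub>R (2 *\<^sub>R r 1 7 - r 3 6 - r 4 5)"
  "e 2 = (sqrt 3 / 12) *\<^sub>R (2 *\<^sub>R r 2 7 - r 3 5 + r 4 6)"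
  "e 3 = (sqrt 3 / 12) *\<^sub>R (- r 1 3 + r 2 4 + 2 *\<^sub>R r 6 7)"
  "e 4 = (sqrt 3 / 12) *\<^sub>R (r 1 4 + r 2 3 - 2 *\<^sub>R r 5 7)"
  "e 5 = (sqrt 3 / 12) *\<^sub>R (- r 1 5 + r 2 6 - 2 *\<^sub>R r 4 7)"
  "e 6 = (sqrt 3 / 12) *\<^sub>R (r 1 6 + r 2 5 + 2 *\<^sub>R r 3 7)"
  unfolding e_def sqrt_3_scale by simp_all

lemmas B0_linear =
  B0.add_left B0.diff_left B0.minus_left B0.scaleR_left B0.zero_left B0.sum_left
  B0.add_right B0.diff_right B0.minus_right B0.scaleR_right B0.zero_right B0.sum_right

lemma e_in_g2: "\<forall>k\<in>{1..6}. e k \<in> g2"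
proof -
  note S = subspace_range_r_comb
  have ax: "axis k (1::real) $ a = (if a = k then 1 else 0)" for k a :: 8
    by (simp add: axis_def)
  have "\<forall>k\<in>{1..6}. e k *v axis 1 1 = 0"
    unfolding Ball_1_6 e_eqs r_def vec_eq_iff forall_8
    by (simp add: matrix_vector_mult.add_left matrix_vector_mult.diff_left
        matrix_vector_mult.minus_left matrix_vector_mult.scaleR_left rho_mult_vec ax
        flip: matrix_vector_mul_assoc)
  moreover have "\<forall>k\<in>{1..6}. e k \<in> range r_comb"
    unfolding Ball_1_6 e_eqs
    by (intro conjI subspace_scale[OF S] subspace_add[OF S] subspace_diff[OF S]
        subspace_neg[OF S] r_in_range_r_comb) simp_all
  ultimately show ?thesis
    by (simp add: g2_iff_annihilates)
qed

text \<open>Each \<open>e k\<close> involves the three $r_{ij}$ of one equation of $\mathfrak g_2$.  That equation expresses,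
  through the coefficient of the one with index 7, the combination of the other two coefficients that
  enters the pairing with \<open>e k\<close>.  So pairing an element of
  $\mathfrak g_2$ with \<open>e k\<close> is as good as reading off one coefficient $\omega_{a7}$.\<close>

lemma B0_g2_e:
  assumes "Z \<in> g2"
  shows "B0 Z (e 1) = sqrt 3 / 4 * B0 Z (r 1 7)"
    and "B0 Z (e 2) = sqrt 3 / 4 * B0 Z (r 2 7)"
    and "B0 Z (e 3) = sqrt 3 / 4 * B0 Z (r 6 7)"
    and "B0 Z (e 4) = - (sqrt 3 / 4) * B0 Z (r 5 7)"
    and "B0 Z (e 5) = - (sqrt 3 / 4) * B0 Z (r 4 7)"
    and "B0 Z (e 6) = sqrt 3 / 4 * B0 Z (r 3 7)"
proof -
  obtain \<omega> where Z: "Z = r_comb \<omega>"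
    and h: "\<omega> 4 5 = - \<omega> 1 7 - \<omega> 3 6" "\<omega> 4 6 = \<omega> 2 7 + \<omega> 3 5" "\<omega> 2 4 = \<omega> 1 3 + \<omega> 6 7"
      "\<omega> 2 3 = - \<omega> 1 4 - \<omega> 5 7" "\<omega> 1 5 = \<omega> 2 6 + \<omega> 4 7" "\<omega> 2 5 = \<omega> 3 7 - \<omega> 1 6"
    using assms by (auto simp: g2_def algebra_simps)
  show
    "B0 Z (e 1) = sqrt 3 / 4 * B0 Z (r 1 7)" "B0 Z (e 2) = sqrt 3 / 4 * B0 Z (r 2 7)"
    "B0 Z (e 3) = sqrt 3 / 4 * B0 Z (r 6 7)" "B0 Z (e 4) = - (sqrt 3 / 4) * B0 Z (r 5 7)"
    "B0 Z (e 5) = - (sqrt 3 / 4) * B0 Z (r 4 7)" "B0 Z (e 6) = sqrt 3 / 4 * B0 Z (r 3 7)"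
    by (simp_all add: Z e_eqs B0_linear B0_r_comb_r h algebra_simps)
qed

lemma e_orthonormal: "\<forall>i\<in>{1..6}. \<forall>j\<in>{1..6}. B0 (e i) (e j) = (if i = j then 1 else 0)"
proof -
  have "\<forall>i\<in>{1..6}. \<forall>a\<in>{1..6}. B0 (e i) (r a 7) = 4 / sqrt 3 *
      (if (i, a) \<in> {(1, 1), (2, 2), (3, 6), (6, 3)} then 1
       else if (i, a) \<in> {(4, 5), (5, 4)} then - 1 else 0)"
    unfolding Ball_1_6 e_eqs by (simp add: B0_linear B0_r real_div_sqrt field_simps)
  then show ?thesis
    using e_in_g2 unfolding Ball_1_6 by (simp add: B0_g2_e)
qed

lemma su3_iff_orthogonal_e: "Z \<in> su3 \<longleftrightarrow> Z \<in> g2 \<and> (\<forall>k\<in>{1..6}. B0 Z (e k) = 0)"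
  unfolding su3_iff_g2_spin6 Ball_1_6 by (auto simp: B0_g2_e)

section \<open>The reductive complement and its connection\<close>

lemma e_in_mm: "k \<in> {1..6} \<Longrightarrow> e k \<in> mm"
  using e_in_g2 by (auto simp: mm_def su3_iff_orthogonal_e B0_commute[of "e k"])

lemma subspace_mm: "subspace mm"
  using subspace_g2 by (auto simp: subspace_def mm_def B0_linear)

text \<open>Subtracting the orthogonal projection to the span of the \<open>e k\<close> leaves an element orthogonal to all
  \<open>e k\<close>, which lies in \<open>su3\<close> by \<open>su3_iff_orthogonal_e\<close>.  So $\mathfrak g_2 = \mathfrak m + \mathfrak{su}(3)$.\<close>

lemma projection_along_su3:
  assumes "Z \<in> g2"
  defines "P \<equiv> \<Sum>k\<in>{1..6}. B0 Z (e k) *\<^sub>R e k"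
  shows "P \<in> mm" and "Z - P \<in> su3"
proof -
  show mm: "P \<in> mm"
    unfolding P_def by (intro subspace_sum[OF subspace_mm] subspace_scale[OF subspace_mm] e_in_mm)
  have "B0 P (e j) = B0 Z (e j)" if "j \<in> {1..6}" for j
  proof -
    have "B0 P (e j) = (\<Sum>k\<in>{1..6}. B0 Z (e k) * B0 (e k) (e j))"
      by (simp add: P_def B0_linear)
    also have "\<dots> = (\<Sum>k\<in>{1..6}. if k = j then B0 Z (e j) else 0)"
      by (intro sum.cong refl) (use that e_orthonormal in auto)
    finally show ?thesis
      using that by simp
  qed
  then show "Z - P \<in> su3"
    using assms(1) mm subspace_diff[OF subspace_g2]
    by (auto simp: su3_iff_orthogonal_e B0_linear mm_def)
qed

text \<open>Such an element is orthogonal to itself, and the form is definite.\<close>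

lemma mm_su3_disjoint: "X \<in> mm \<Longrightarrow> X \<in> su3 \<Longrightarrow> X = 0"
  by (rule B0_definite_on_r_comb) (auto simp: mm_def g2_iff_annihilates)

lemma subspace_su3: "subspace su3"
  using subspace_g2 by (auto simp: subspace_def su3_iff_orthogonal_e B0_linear)

lemma m_part_unique:
  assumes "Y \<in> mm" and "Z - Y \<in> su3"
  shows "m_part Z = Y"
  unfolding m_part_def
proof (rule the_equality)
  fix Y' assume Y': "Y' \<in> mm \<and> Z - Y' \<in> su3"
  have "Y' - Y \<in> mm"
    using Y' assms(1) by (blast intro: subspace_diff[OF subspace_mm])
  moreover have "(Z - Y) - (Z - Y') \<in> su3"
    using Y' assms(2) by (blast intro: subspace_diff[OF subspace_su3])
  ultimately show "Y' = Y"
    using mm_su3_disjoint[of "Y' - Y"] by simp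
qed (use assms in blast)

lemma m_part_eq: "Z \<in> g2 \<Longrightarrow> m_part Z = (\<Sum>k\<in>{1..6}. B0 Z (e k) *\<^sub>R e k)"
  by (intro m_part_unique projection_along_su3)

text \<open>An element of \<open>mm\<close> is its own projection, so the \<open>e k\<close> span \<open>mm\<close>.\<close>

lemma mm_expansion: "X \<in> mm \<Longrightarrow> X = (\<Sum>k\<in>{1..6}. B0 X (e k) *\<^sub>R e k)"
  using m_part_unique[of X X] m_part_eq[of X] subspace_0[OF subspace_su3] by (simp add: mm_def)

lemma B0_m_part:
  assumes "Z \<in> g2" and "W \<in> mm"
  shows "B0 (m_part Z) W = B0 Z W"
proof -
  have "Z - m_part Z \<in> su3"
    using projection_along_su3(2) m_part_eq assms(1) by simp
  then have "B0 W (Z - m_part Z) = 0"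
    using assms(2) by (auto simp: mm_def)
  then show ?thesis
    by (simp add: B0_linear B0_commute[of W])
qed

text \<open>The right-hand side of the equation defining \<open>U\<close> is $B_0([Z,X],Y) + B_0([Z,Y],X)$, as the projections
  do not affect pairings with elements of \<open>mm\<close>.  By invariance this is
  $B_0(Z, [X,Y] + [Y,X]) = 0$: the space is naturally reductive.\<close>

lemma U_eq_0:
  assumes "X \<in> mm" and "Y \<in> mm"
  shows "U X Y = 0"
  unfolding U_def
proof (rule the_equality)
  have mixed: "B0 (m_part (commutator Z X)) Y + B0 X (m_part (commutator Z Y)) = 0"
    if "Z \<in> mm" for Z
  proof -
    have "B0 (m_part (commutator Z X)) Y + B0 X (m_part (commutator Z Y))
        = B0 (commutator Z X) Y + B0 (commutator Z Y) X"
      using assms that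
      by (simp add: B0_commute[of X] B0_m_part commutator_g2 mm_def)
    also have "\<dots> = B0 Z (commutator X Y + commutator Y X)"
      by (simp add: B0_commutator B0_linear)
    finally show ?thesis
      by (simp add: commutator_swap[of X Y] B0_linear)
  qed
  then show "0 \<in> mm \<and> (\<forall>Z\<in>mm. 2 * B0 0 Z =
      B0 (m_part (commutator Z X)) Y + B0 X (m_part (commutator Z Y)))"
    by (simp add: subspace_0[OF subspace_mm] B0_linear)
  fix W
  assume W: "W \<in> mm \<and> (\<forall>Z\<in>mm. 2 * B0 W Z =
      B0 (m_part (commutator Z X)) Y + B0 X (m_part (commutator Z Y)))"
  then have "B0 W W = 0"
    using mixed by simp
  then show "W = 0"
    using W B0_definite_on_r_comb[of W] by (simp add: mm_def g2_iff_annihilates)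
qed

lemma B0_Lambda_g:
  assumes "X \<in> mm" and "Y \<in> mm" and "W \<in> mm"
  shows "B0 (Lambda_g X Y) W = B0 (commutator X Y) W / 2"
  using assms by (simp add: Lambda_g_def U_eq_0 B0_linear B0_m_part commutator_g2 mm_def)

section \<open>The action of $\mathfrak g_2$ on the orthonormal basis\<close>

lemma B0_r_swap:
  assumes "i \<in> {1..7}" and "j \<in> {1..7}" and "i < j"
  shows "B0 Z (r j i) = - B0 Z (r i j)"
  using assms r_swap[of i j] by (simp add: B0_linear)

lemma sqrt_3_mult: "sqrt 3 * (sqrt 3 * x) = 3 * x"
  by (simp flip: mult.assoc)

text \<open>By invariance each line computes one bracket $[e_i, e_j]$.  The same table serves for the isotropy
  representation, with \<open>Z\<close> in \<open>su3\<close>, and for the connection, with \<open>Z\<close> in \<open>mm\<close>.\<close>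

lemma B0_commutator_e_e:
  "B0 (commutator Z (e 1)) (e 2) = (2 * B0 Z (r 1 2) - B0 Z (r 3 4) - B0 Z (r 5 6)) / 12"
  "B0 (commutator Z (e 1)) (e 3) = (5 * B0 Z (r 1 6) - B0 Z (r 2 5) + 4 * B0 Z (r 3 7)) / 24"
  "B0 (commutator Z (e 1)) (e 4) = (- 5 * B0 Z (r 1 5) - B0 Z (r 2 6) - 4 * B0 Z (r 4 7)) / 24"
  "B0 (commutator Z (e 1)) (e 5) = (- 5 * B0 Z (r 1 4) + B0 Z (r 2 3) + 4 * B0 Z (r 5 7)) / 24"
  "B0 (commutator Z (e 1)) (e 6) = (5 * B0 Z (r 1 3) + B0 Z (r 2 4) - 4 * B0 Z (r 6 7)) / 24"
  "B0 (commutator Z (e 2)) (e 3) = (B0 Z (r 1 5) + 5 * B0 Z (r 2 6) - 4 * B0 Z (r 4 7)) / 24"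
  "B0 (commutator Z (e 2)) (e 4) = (B0 Z (r 1 6) - 5 * B0 Z (r 2 5) - 4 * B0 Z (r 3 7)) / 24"
  "B0 (commutator Z (e 2)) (e 5) = (- B0 Z (r 1 3) - 5 * B0 Z (r 2 4) - 4 * B0 Z (r 6 7)) / 24"
  "B0 (commutator Z (e 2)) (e 6) = (- B0 Z (r 1 4) + 5 * B0 Z (r 2 3) - 4 * B0 Z (r 5 7)) / 24"
  "B0 (commutator Z (e 3)) (e 4) = (- B0 Z (r 1 2) - B0 Z (r 3 4) + 2 * B0 Z (r 5 6)) / 12"
  "B0 (commutator Z (e 3)) (e 5) = (4 * B0 Z (r 2 7) + B0 Z (r 3 5) + 5 * B0 Z (r 4 6)) / 24"
  "B0 (commutator Z (e 3)) (e 6) = (4 * B0 Z (r 1 7) - 5 * B0 Z (r 3 6) + B0 Z (r 4 5)) / 24"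
  "B0 (commutator Z (e 4)) (e 5) = (4 * B0 Z (r 1 7) + B0 Z (r 3 6) - 5 * B0 Z (r 4 5)) / 24"
  "B0 (commutator Z (e 4)) (e 6) = (- 4 * B0 Z (r 2 7) + 5 * B0 Z (r 3 5) + B0 Z (r 4 6)) / 24"
  "B0 (commutator Z (e 5)) (e 6) = (- B0 Z (r 1 2) + 2 * B0 Z (r 3 4) - B0 Z (r 5 6)) / 12"
  by (simp_all add: B0_commutator e_eqs commutator.add_left commutator.diff_left
      commutator.minus_left commutator.scaleR_left commutator.add_right commutator.diff_right
      commutator.minus_right commutator.scaleR_right commutator_r B0_linear B0_r_swap sqrt_3_mult
      algebra_simps)

lemma sum_1_6: "(\<Sum>i\<in>{1..6::nat}. f i) = f 1 + f 2 + f 3 + f 4 + f 5 + f 6"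
  for f :: "nat \<Rightarrow> 'a::comm_monoid_add"
proof -
  have "{1..6::nat} = {1,2,3,4,5,6}" by auto
  then show ?thesis by (simp add: add.assoc)
qed

lemma B0_mm_left:
  assumes "X \<in> mm"
  shows "B0 X Y = B0 X (e 1) * B0 (e 1) Y + B0 X (e 2) * B0 (e 2) Y + B0 X (e 3) * B0 (e 3) Y
      + B0 X (e 4) * B0 (e 4) Y + B0 X (e 5) * B0 (e 5) Y + B0 X (e 6) * B0 (e 6) Y"
  by (subst mm_expansion[OF assms]) (simp only: sum_1_6 B0.add_left B0.scaleR_left real_scaleR_def)

text \<open>Pairing with $r_{ij}$ is a multiple of pairing with the only \<open>e k\<close>, if any, that involves $r_{ij}$.\<close>

lemma B0_r_mm:
  assumes "X \<in> mm"
  shows "B0 X (r 1 2) = 0"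
    "B0 X (r 1 3) = -2 * sqrt 3 / 3 * B0 X (e 3)"
    "B0 X (r 1 4) = 2 * sqrt 3 / 3 * B0 X (e 4)"
    "B0 X (r 1 5) = -2 * sqrt 3 / 3 * B0 X (e 5)"
    "B0 X (r 1 6) = 2 * sqrt 3 / 3 * B0 X (e 6)"
    "B0 X (r 1 7) = 4 * sqrt 3 / 3 * B0 X (e 1)"
    "B0 X (r 2 3) = 2 * sqrt 3 / 3 * B0 X (e 4)"
    "B0 X (r 2 4) = 2 * sqrt 3 / 3 * B0 X (e 3)"
    "B0 X (r 2 5) = 2 * sqrt 3 / 3 * B0 X (e 6)"
    "B0 X (r 2 6) = 2 * sqrt 3 / 3 * B0 X (e 5)"
    "B0 X (r 2 7) = 4 * sqrt 3 / 3 * B0 X (e 2)"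
    "B0 X (r 3 4) = 0"
    "B0 X (r 3 5) = -2 * sqrt 3 / 3 * B0 X (e 2)"
    "B0 X (r 3 6) = -2 * sqrt 3 / 3 * B0 X (e 1)"
    "B0 X (r 3 7) = 4 * sqrt 3 / 3 * B0 X (e 6)"
    "B0 X (r 4 5) = -2 * sqrt 3 / 3 * B0 X (e 1)"
    "B0 X (r 4 6) = 2 * sqrt 3 / 3 * B0 X (e 2)"
    "B0 X (r 4 7) = -4 * sqrt 3 / 3 * B0 X (e 5)"
    "B0 X (r 5 6) = 0"
    "B0 X (r 5 7) = -4 * sqrt 3 / 3 * B0 X (e 4)"
    "B0 X (r 6 7) = 4 * sqrt 3 / 3 * B0 X (e 3)"
  by (subst B0_mm_left[OF assms]; simp add: e_eqs B0_linear B0_r)+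

text \<open>The equations are those between the entries of a skew-symmetric real matrix that is complex linear with
  trace zero on $\mathbb{C}^3$, for the complex structure $e_{2j-1} \mapsto e_{2j}$.\<close>

lemma isotropy_su3:
  assumes "h \<in> su3"
  defines "M i j \<equiv> B0 (commutator h (e i)) (e j)"
  shows "M 3 4 = - M 1 2 - M 5 6" "M 2 4 = M 1 3" "M 2 3 = - M 1 4" "M 2 6 = M 1 5" "M 2 5 = - M 1 6"
    "M 4 6 = M 3 5" "M 4 5 = - M 3 6"
proof -
  obtain \<omega> where "h = r_comb \<omega>" "\<omega> 5 6 = - \<omega> 1 2 - \<omega> 3 4" "\<omega> 2 4 = \<omega> 1 3" "\<omega> 2 3 = - \<omega> 1 4"
    "\<omega> 2 6 = \<omega> 1 5" "\<omega> 2 5 = - \<omega> 1 6" "\<omega> 4 6 = \<omega> 3 5" "\<omega> 4 5 = - \<omega> 3 6"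
    "\<omega> 1 7 = 0" "\<omega> 2 7 = 0" "\<omega> 3 7 = 0" "\<omega> 4 7 = 0" "\<omega> 5 7 = 0" "\<omega> 6 7 = 0"
    using assms(1) by (auto simp: su3_def Ball_1_6)
  note h = this
  show "M 3 4 = - M 1 2 - M 5 6" "M 2 4 = M 1 3" "M 2 3 = - M 1 4" "M 2 6 = M 1 5" "M 2 5 = - M 1 6"
    "M 4 6 = M 3 5" "M 4 5 = - M 3 6"
    by (simp_all add: M_def h(1) B0_commutator_e_e B0_r_comb_r h(2-) field_simps)
qed

text \<open>These are the contractions with \<open>X\<close> of the totally skew form
  $\frac{1}{\sqrt 3} (e_{136} + e_{145} + e_{235} - e_{246})$, with $e_{ijk} = e_i \wedge e_j \wedge e_k$.\<close>

lemma B0_commutator_mm_e_e: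
  assumes "X \<in> mm"
  shows "B0 (commutator X (e 1)) (e 2) = 0"
    "B0 (commutator X (e 1)) (e 3) = sqrt 3 / 3 * B0 X (e 6)"
    "B0 (commutator X (e 1)) (e 4) = sqrt 3 / 3 * B0 X (e 5)"
    "B0 (commutator X (e 1)) (e 5) = - sqrt 3 / 3 * B0 X (e 4)"
    "B0 (commutator X (e 1)) (e 6) = - sqrt 3 / 3 * B0 X (e 3)"
    "B0 (commutator X (e 2)) (e 3) = sqrt 3 / 3 * B0 X (e 5)"
    "B0 (commutator X (e 2)) (e 4) = - sqrt 3 / 3 * B0 X (e 6)"
    "B0 (commutator X (e 2)) (e 5) = - sqrt 3 / 3 * B0 X (e 3)"
    "B0 (commutator X (e 2)) (e 6) = sqrt 3 / 3 * B0 X (e 4)"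
    "B0 (commutator X (e 3)) (e 4) = 0"
    "B0 (commutator X (e 3)) (e 5) = sqrt 3 / 3 * B0 X (e 2)"
    "B0 (commutator X (e 3)) (e 6) = sqrt 3 / 3 * B0 X (e 1)"
    "B0 (commutator X (e 4)) (e 5) = sqrt 3 / 3 * B0 X (e 1)"
    "B0 (commutator X (e 4)) (e 6) = - sqrt 3 / 3 * B0 X (e 2)"
    "B0 (commutator X (e 5)) (e 6) = 0"
  by (simp_all add: B0_commutator_e_e B0_r_mm[OF assms])

section \<open>Clifford multiplication in coordinates\<close>

lemma less_3: "(3::3) < 1" "(3::3) < 2" "(1::3) < 2"
  by (simp_all add: less_bit1_def bit1.Rep_numeral bit1.Rep_1)

text \<open>The order of the type \<^typ>\<open>3\<close> is 3 < 1 < 2, and the cardinalities are the exponents of the signs in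
  \<open>contract\<close> and in the wedge product.\<close>

lemma card_less_3:
  fixes I :: "3 set"
  shows "card {i \<in> I. i < 3} = 0"
    and "card {i \<in> I. i < 1} = (if 3 \<in> I then 1 else 0)"
    and "card {i \<in> I. i < 2} = (if 3 \<in> I then 1 else 0) + (if 1 \<in> I then 1 else 0)"
proof -
  have *: "\<not> i < 3" "i < 1 \<longleftrightarrow> i = 3" "i < 2 \<longleftrightarrow> i = 3 \<or> i = 1" for i :: 3
    using exhaust_3[of i] less_3 by auto
  show "card {i \<in> I. i < 3} = 0"
    by (simp add: *)
  have "{i \<in> I. i < 1} = (if 3 \<in> I then {3} else {})"
    "{i \<in> I. i < 2} = (if 3 \<in> I then {3} else {}) \<union> (if 1 \<in> I then {1} else {})"
    unfolding * by auto
  then show "card {i \<in> I. i < 1} = (if 3 \<in> I then 1 else 0)"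
    "card {i \<in> I. i < 2} = (if 3 \<in> I then 1 else 0) + (if 1 \<in> I then 1 else 0)"
    by auto
qed

lemma subsets_3: "(\<forall>I::3 set. P I) \<longleftrightarrow>
    P {} \<and> P {1} \<and> P {2} \<and> P {3} \<and> P {1, 2} \<and> P {1, 3} \<and> P {2, 3} \<and> P {1, 2, 3}"
proof -
  have "(\<forall>I::3 set. P I) \<longleftrightarrow> (\<forall>I \<in> Pow {1, 2, 3}. P I)"
    using UNIV_3 by auto
  also have "Pow {1, 2, 3} = {{}, {1}, {2}, {3::3}, {1, 2}, {1, 3}, {2, 3}, {1, 2, 3}}"
    by (simp add: Pow_insert image_Un insert_commute Un_insert_left Un_insert_right)
  finally show ?thesis by simp
qed

lemma contract_nth:
  "contract 1 \<eta> $ I = (if 1 \<in> I then 0 else (if 3 \<in> I then - 1 else 1) * \<eta> $ insert 1 I)"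
  "contract 2 \<eta> $ I = (if 2 \<in> I then 0 else
    (if 3 \<in> I then - 1 else 1) * (if 1 \<in> I then - 1 else 1) * \<eta> $ insert 2 I)"
  "contract 3 \<eta> $ I = (if 3 \<in> I then 0 else \<eta> $ insert 3 I)"
  by (simp_all add: contract_def card_less_3)

lemma y_wedge_nth_3:
  "(y 1 \<and>\<^sub>\<Lambda> \<eta>) $ I = (if 1 \<in> I then (if 3 \<in> I then - 1 else 1) * \<eta> $ (I - {1}) else 0)"
  "(y 2 \<and>\<^sub>\<Lambda> \<eta>) $ I = (if 2 \<in> I then
    (if 3 \<in> I then - 1 else 1) * (if 1 \<in> I then - 1 else 1) * \<eta> $ (I - {2}) else 0)"
  "(y 3 \<and>\<^sub>\<Lambda> \<eta>) $ I = (if 3 \<in> I then \<eta> $ (I - {3}) else 0)"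
  by (simp_all add: y_wedge_nth card_less_3)

text \<open>Subsets written with their elements in increasing numerical order are the normal form in which the
  coordinates of a spinor are indexed.\<close>

lemma insert_3_commute:
  "insert 2 {1::3} = {1, 2}" "insert 3 {1::3} = {1, 3}" "insert 3 {2::3} = {2, 3}"
    "insert 2 {1::3, 3} = {1, 2, 3}" "insert 3 {1::3, 2} = {1, 2, 3}"
  by auto

text \<open>Multiplication by $e_{2j-1}$ or $e_{2j}$ permutes the monomials up to a factor: it adds $y_j$ or
  removes it.\<close>

lemma cliff_e_nth:
  "cliff_e 1 \<eta> $ {} = \<i> * \<eta> $ {1}" "cliff_e 1 \<eta> $ {1} = \<i> * \<eta> $ {}"
  "cliff_e 1 \<eta> $ {2} = \<i> * \<eta> $ {1, 2}" "cliff_e 1 \<eta> $ {3} = - \<i> * \<eta> $ {1, 3}"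
  "cliff_e 1 \<eta> $ {1, 2} = \<i> * \<eta> $ {2}" "cliff_e 1 \<eta> $ {1, 3} = - \<i> * \<eta> $ {3}"
  "cliff_e 1 \<eta> $ {2, 3} = - \<i> * \<eta> $ {1, 2, 3}" "cliff_e 1 \<eta> $ {1, 2, 3} = - \<i> * \<eta> $ {2, 3}"
  "cliff_e 2 \<eta> $ {} = - \<eta> $ {1}" "cliff_e 2 \<eta> $ {1} = \<eta> $ {}"
  "cliff_e 2 \<eta> $ {2} = - \<eta> $ {1, 2}" "cliff_e 2 \<eta> $ {3} = \<eta> $ {1, 3}"
  "cliff_e 2 \<eta> $ {1, 2} = \<eta> $ {2}" "cliff_e 2 \<eta> $ {1, 3} = - \<eta> $ {3}"
  "cliff_e 2 \<eta> $ {2, 3} = \<eta> $ {1, 2, 3}" "cliff_e 2 \<eta> $ {1, 2, 3} = - \<eta> $ {2, 3}"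
  "cliff_e 3 \<eta> $ {} = \<i> * \<eta> $ {2}" "cliff_e 3 \<eta> $ {1} = - \<i> * \<eta> $ {1, 2}"
  "cliff_e 3 \<eta> $ {2} = \<i> * \<eta> $ {}" "cliff_e 3 \<eta> $ {3} = - \<i> * \<eta> $ {2, 3}"
  "cliff_e 3 \<eta> $ {1, 2} = - \<i> * \<eta> $ {1}" "cliff_e 3 \<eta> $ {1, 3} = \<i> * \<eta> $ {1, 2, 3}"
  "cliff_e 3 \<eta> $ {2, 3} = - \<i> * \<eta> $ {3}" "cliff_e 3 \<eta> $ {1, 2, 3} = \<i> * \<eta> $ {1, 3}"
  "cliff_e 4 \<eta> $ {} = - \<eta> $ {2}" "cliff_e 4 \<eta> $ {1} = \<eta> $ {1, 2}"
  "cliff_e 4 \<eta> $ {2} = \<eta> $ {}" "cliff_e 4 \<eta> $ {3} = \<eta> $ {2, 3}"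
  "cliff_e 4 \<eta> $ {1, 2} = - \<eta> $ {1}" "cliff_e 4 \<eta> $ {1, 3} = - \<eta> $ {1, 2, 3}"
  "cliff_e 4 \<eta> $ {2, 3} = - \<eta> $ {3}" "cliff_e 4 \<eta> $ {1, 2, 3} = \<eta> $ {1, 3}"
  "cliff_e 5 \<eta> $ {} = \<i> * \<eta> $ {3}" "cliff_e 5 \<eta> $ {1} = \<i> * \<eta> $ {1, 3}"
  "cliff_e 5 \<eta> $ {2} = \<i> * \<eta> $ {2, 3}" "cliff_e 5 \<eta> $ {3} = \<i> * \<eta> $ {}"
  "cliff_e 5 \<eta> $ {1, 2} = \<i> * \<eta> $ {1, 2, 3}" "cliff_e 5 \<eta> $ {1, 3} = \<i> * \<eta> $ {1}"
  "cliff_e 5 \<eta> $ {2, 3} = \<i> * \<eta> $ {2}" "cliff_e 5 \<eta> $ {1, 2, 3} = \<i> * \<eta> $ {1, 2}"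
  "cliff_e 6 \<eta> $ {} = - \<eta> $ {3}" "cliff_e 6 \<eta> $ {1} = - \<eta> $ {1, 3}"
  "cliff_e 6 \<eta> $ {2} = - \<eta> $ {2, 3}" "cliff_e 6 \<eta> $ {3} = \<eta> $ {}"
  "cliff_e 6 \<eta> $ {1, 2} = - \<eta> $ {1, 2, 3}" "cliff_e 6 \<eta> $ {1, 3} = \<eta> $ {1}"
  "cliff_e 6 \<eta> $ {2, 3} = \<eta> $ {2}" "cliff_e 6 \<eta> $ {1, 2, 3} = \<eta> $ {1, 2}"
  by (simp_all add: cliff_e_def contract_nth y_wedge_nth_3 insert_3_commute insert_Diff_if)

lemma sum_pairs_6:
  fixes f :: "nat \<Rightarrow> nat \<Rightarrow> 'a::comm_monoid_add"
  shows "(\<Sum>i\<in>{1..6}. \<Sum>j\<in>{i<..6}. f i j) =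
    f 1 2 + f 1 3 + f 1 4 + f 1 5 + f 1 6 + f 2 3 + f 2 4 + f 2 5 + f 2 6 +
    f 3 4 + f 3 5 + f 3 6 + f 4 5 + f 4 6 + f 5 6"
proof -
  have I: "{1..6::nat} = {1,2,3,4,5,6}" "{1<..6::nat} = {2,3,4,5,6}" "{2<..6::nat} = {3,4,5,6}"
    "{3<..6::nat} = {4,5,6}" "{4<..6::nat} = {5,6}" "{5<..6::nat} = {6}"
    by auto
  show ?thesis
    unfolding I(1) by (simp add: I(2-) add.assoc)
qed

lemma cliff_e_basis:
  assumes "k \<in> {1..6}"
  shows "cliff (e k) \<eta> = cliff_e k \<eta>"
proof -
  have "cliff (e k) \<eta> = (\<Sum>i\<in>{1..6}. if i = k then cliff_e k \<eta> else 0)"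
    unfolding cliff_def by (intro sum.cong refl) (use assms e_orthonormal in auto)
  with assms show ?thesis
    by simp
qed

lemma spin_lift_eq:
  "spin_lift A \<psi> = (\<Sum>i\<in>{1..6}. \<Sum>j\<in>{i<..6}.
     (B0 (A (e i)) (e j) / 2) *\<^sub>R cliff_e i (cliff_e j \<psi>))"
  unfolding spin_lift_def by (intro sum.cong refl) (simp add: cliff_e_basis)

lemma cliff_eq:
  "cliff X \<eta> = B0 X (e 1) *\<^sub>R cliff_e 1 \<eta> + B0 X (e 2) *\<^sub>R cliff_e 2 \<eta> + B0 X (e 3) *\<^sub>R cliff_e 3 \<eta>
    + B0 X (e 4) *\<^sub>R cliff_e 4 \<eta> + B0 X (e 5) *\<^sub>R cliff_e 5 \<eta> + B0 X (e 6) *\<^sub>R cliff_e 6 \<eta>"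
  unfolding cliff_def sum_1_6 ..

section \<open>Invariant spinors\<close>

lemma spinor_eq_iff: "\<phi> = \<psi> \<longleftrightarrow> \<phi> $ {} = \<psi> $ {} \<and> \<phi> $ {1} = \<psi> $ {1} \<and> \<phi> $ {2} = \<psi> $ {2}
    \<and> \<phi> $ {3} = \<psi> $ {3} \<and> \<phi> $ {1, 2} = \<psi> $ {1, 2} \<and> \<phi> $ {1, 3} = \<psi> $ {1, 3}
    \<and> \<phi> $ {2, 3} = \<psi> $ {2, 3} \<and> \<phi> $ {1, 2, 3} = \<psi> $ {1, 2, 3}" for \<phi> \<psi> :: spinor
  unfolding vec_eq_iff subsets_3 by blast

lemma y_nth: "y j $ I = (if I = {j} then 1 else 0)"
  by (simp add: y_def axis_def)

lemma volume_nth: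
  defines "vol \<equiv> y 1 \<and>\<^sub>\<Lambda> y 2 \<and>\<^sub>\<Lambda> y 3"
  shows "vol $ {} = 0" "vol $ {1} = 0" "vol $ {2} = 0" "vol $ {3} = 0"
    "vol $ {1, 2} = 0" "vol $ {1, 3} = 0" "vol $ {2, 3} = 0" "vol $ {1, 2, 3} = 1"
  by (simp_all add: vol_def y_wedge_nth_3 y_nth insert_Diff_if)

lemma ext_one_nth:
  "ext_one $ {} = 1" "I \<noteq> {} \<Longrightarrow> ext_one $ I = 0"
  by (auto simp: ext_one_def axis_def)

lemma scaleR_nth: "(c *\<^sub>R \<eta>) $ I = of_real c * \<eta> $ I" for \<eta> :: spinor
  using scaleR_conv_of_real[of c "\<eta> $ I"] by simp

lemma span_one_volume_iff: "\<psi> \<in> vec.span {ext_one, y 1 \<and>\<^sub>\<Lambda> y 2 \<and>\<^sub>\<Lambda> y 3} \<longleftrightarrow>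
    \<psi> $ {1} = 0 \<and> \<psi> $ {2} = 0 \<and> \<psi> $ {3} = 0
    \<and> \<psi> $ {1, 2} = 0 \<and> \<psi> $ {1, 3} = 0 \<and> \<psi> $ {2, 3} = 0"
proof -
  have "\<psi> \<in> vec.span {ext_one, y 1 \<and>\<^sub>\<Lambda> y 2 \<and>\<^sub>\<Lambda> y 3} \<longleftrightarrow>
      (\<exists>a b. \<psi> - a *s ext_one = b *s (y 1 \<and>\<^sub>\<Lambda> y 2 \<and>\<^sub>\<Lambda> y 3))"
    by (auto simp: vec.span_insert vec.span_singleton image_iff)
  also have "\<dots> \<longleftrightarrow> \<psi> $ {1} = 0 \<and> \<psi> $ {2} = 0 \<and> \<psi> $ {3} = 0
    \<and> \<psi> $ {1, 2} = 0 \<and> \<psi> $ {1, 3} = 0 \<and> \<psi> $ {2, 3} = 0"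
    unfolding spinor_eq_iff by (auto simp: ext_one_nth volume_nth)
  finally show ?thesis .
qed

text \<open>The diagonal part of the isotropy matrix multiplies 1 and $y_1 \wedge y_2 \wedge y_3$ by $\pm \frac{i}{2}$
  times its complex trace, which is zero; the components in $\Lambda^2$ and $\Lambda^1$ cancel by complex
  linearity.\<close>

lemma su3_annihilates_span:
  assumes "h \<in> su3" and "\<psi> \<in> vec.span {ext_one, y 1 \<and>\<^sub>\<Lambda> y 2 \<and>\<^sub>\<Lambda> y 3}"
  shows "spin_lift (commutator h) \<psi> = 0"
  using assms(2)
  unfolding span_one_volume_iff spin_lift_eq sum_pairs_6 spinor_eq_iff isotropy_su3[OF assms(1)]
  by (simp add: scaleR_nth cliff_e_nth field_simps del: vector_scaleR_component)

text \<open>The torus element $a r_{12} + b r_{34} + c r_{56}$ rotates the three coordinate planes of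
  $\mathfrak m$, and $e_{2j-1} \cdot e_{2j}$ multiplies a monomial by $\pm i$ according to whether it
  contains $y_j$.  The numbers \<open>b\<close> and \<open>c\<close> belong to $y_3$ and $y_2$, since in the identification of
  $\mathfrak m$ with $\mathbb{R}^6$ by the components along $r_{17}, \dots, r_{67}$ the plane of
  $e_3, e_4$ is the one with indices 5 and 6.\<close>

lemma weight_of_invariant_spinor:
  fixes a b c :: real
  assumes "\<psi> \<in> Sigma_inv" and "a + b + c = 0"
  shows "complex_of_real ((if 1 \<in> I then - a else a) + (if 2 \<in> I then - c else c)
    + (if 3 \<in> I then - b else b)) * \<psi> $ I = 0" (is "?w I * _ = 0")
proof -
  define \<omega> :: "nat \<Rightarrow> nat \<Rightarrow> real" where "\<omega> = (\<lambda>i j.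
    if (i, j) = (1, 2) then a else if (i, j) = (3, 4) then b else if (i, j) = (5, 6) then c else 0)"
  have "r_comb \<omega> \<in> su3"
    unfolding su3_def mem_Collect_eq using assms(2) by (intro exI[of _ \<omega>]) (auto simp: \<omega>_def)
  then have "spin_lift (commutator (r_comb \<omega>)) \<psi> = 0"
    using assms(1) by (simp add: Sigma_inv_def)
  moreover have "\<forall>I. spin_lift (commutator (r_comb \<omega>)) \<psi> $ I = \<i> * ?w I * \<psi> $ I"
  proof -
    have c: "c = - a - b"
      using assms(2) by simp
    show ?thesis
      unfolding subsets_3 spin_lift_eq sum_pairs_6 B0_commutator_e_e \<omega>_def c
      by (simp add: B0_r_comb_r scaleR_nth cliff_e_nth field_simps del: vector_scaleR_component)
  qed
  ultimately have "\<i> * ?w I * \<psi> $ I = 0"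
    by (metis zero_index)
  then show ?thesis
    by simp
qed

section \<open>The Killing equation\<close>

lemma nabla_g_eq:
  assumes "X \<in> mm"
  shows "nabla_g X \<psi> = (\<Sum>i\<in>{1..6}. \<Sum>j\<in>{i<..6}.
     (B0 (commutator X (e i)) (e j) / 4) *\<^sub>R cliff_e i (cliff_e j \<psi>))"
  unfolding nabla_g_def spin_lift_eq by (intro sum.cong refl) (simp add: B0_Lambda_g assms e_in_mm)

text \<open>Both sides are linear in the coefficients of \<open>X\<close>, and the contractions of \<open>B0_commutator_mm_e_e\<close> act on
  the two monomials by degree 2 Clifford products.  Replacing \<open>s\<close> by its negative changes the sign of the
  factor because the 3-form exchanges the two monomials.\<close>

lemma nabla_one_plus_volume:
  assumes "X \<in> mm" and "s = 1 \<or> s = - 1"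
  shows "nabla_g X (ext_one + s *\<^sub>R y 1 \<and>\<^sub>\<Lambda> y 2 \<and>\<^sub>\<Lambda> y 3) =
    (s / (2 * sqrt 3)) *\<^sub>R cliff X (ext_one + s *\<^sub>R y 1 \<and>\<^sub>\<Lambda> y 2 \<and>\<^sub>\<Lambda> y 3)"
proof -
  have s3: "s / (2 * sqrt 3) = s * (sqrt 3 / 6)"
    by (simp add: field_simps)
  show ?thesis
    unfolding nabla_g_eq[OF assms(1)] sum_pairs_6 cliff_eq B0_commutator_mm_e_e[OF assms(1)]
      spinor_eq_iff s3
    using assms(2)
    by (elim disjE; simp add: scaleR_nth cliff_e_nth ext_one_nth volume_nth field_simps
        del: vector_scaleR_component)
qed

theorem theorem5p1:
  shows "Sigma_inv = vec.span {ext_one, y 1 \<and>\<^sub>\<Lambda> y 2 \<and>\<^sub>\<Lambda> y 3}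
    \<and> (\<forall>X\<in>mm. nabla_g X psi_plus = (1 / (2 * sqrt 3)) *\<^sub>R cliff X psi_plus)
    \<and> (\<forall>X\<in>mm. nabla_g X psi_minus = - (1 / (2 * sqrt 3)) *\<^sub>R cliff X psi_minus)"
proof (intro conjI ballI set_eqI iffI)
  fix \<psi> assume "\<psi> \<in> Sigma_inv"
  \<comment> \<open>Any three nonzero numbers with sum zero would do: changing some but not all signs in a
    zero sum of three terms leaves twice one of the terms, up to sign.\<close>
  note weights = weight_of_invariant_spinor[OF \<open>\<psi> \<in> Sigma_inv\<close>, of 1 2 "- 3"]
  show "\<psi> \<in> vec.span {ext_one, y 1 \<and>\<^sub>\<Lambda> y 2 \<and>\<^sub>\<Lambda> y 3}"
    unfolding span_one_volume_iff
    using weights[of "{1}"] weights[of "{2}"] weights[of "{3}"]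
      weights[of "{1, 2}"] weights[of "{1, 3}"] weights[of "{2, 3}"]
    by simp
next
  fix \<psi> assume "\<psi> \<in> vec.span {ext_one, y 1 \<and>\<^sub>\<Lambda> y 2 \<and>\<^sub>\<Lambda> y 3}"
  then show "\<psi> \<in> Sigma_inv"
    by (simp add: Sigma_inv_def su3_annihilates_span)
next
  fix X assume "X \<in> mm"
  then show "nabla_g X psi_plus = (1 / (2 * sqrt 3)) *\<^sub>R cliff X psi_plus"
    using nabla_one_plus_volume[of X 1] by (simp add: psi_plus_def)
next
  fix X assume "X \<in> mm"
  then show "nabla_g X psi_minus = - (1 / (2 * sqrt 3)) *\<^sub>R cliff X psi_minus"
    using nabla_one_plus_volume[of X "-1"] by (simp add: psi_minus_def)
qed

end
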